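(* Let $e\in\{2,3,4\}$ and let $j_e\in\mathbb{Z}^+$ be the smallest integer such that $j_e!>j_e^{e-1}$. If $n\in\mathbb{Z}^+$ with $n>M_e$, where $M_e=\sum_{i=1}^{j_e} i\cdot i!$, then $n-S_{e,!}(n)>0$.
   Context: Every positive integer $n$ has a unique factoradic (factorial base) representation $n=\sum_{i=1}^k a_i\cdot i!$ with $a_k\neq 0$ and $0\leq a_i\leq i$ for $1\leq i\leq k$. For an integer $e\geq 1$, the $e$-power factoradic happy function $S_{e,!}:\mathbb{Z}_{\geq 0}\to\mathbb{Z}_{\geq 0}$ is defined by $S_{e,!}(0)=0$ and $S_{e,!}(n)=\sum_{i=1}^k a_i^e$ for $n\geq 1$. *)

theory Defs
  imports Main "HOL.Factorial"
begin

text \<open>\<^term>\<open>k\<close> is the index of the leading digit; the values of \<^term>\<open>a\<close> outside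
  \<open>{1..k}\<close> are irrelevant.\<close>

definition is_factoradic :: "nat \<Rightarrow> nat \<Rightarrow> (nat \<Rightarrow> nat) \<Rightarrow> bool" where
  "is_factoradic n k a \<longleftrightarrow>
     k \<ge> 1 \<and> a k \<noteq> 0 \<and> (\<forall>i\<in>{1..k}. a i \<le> i) \<and> n = (\<Sum>i=1..k. a i * fact i)"

lemma factoradic_sum_less:
  fixes a :: "nat \<Rightarrow> nat"
  assumes "\<forall>i\<in>{1..k}. a i \<le> i"
  shows "(\<Sum>i=1..k. a i * fact i) < fact (Suc k)"
  using assms
proof (induction k)
  case (Suc k)
  have "(\<Sum>i=1..k. a i * fact i) < fact (Suc k)" using Suc by simp
  moreover have "a (Suc k) * fact (Suc k) \<le> Suc k * fact (Suc k)"
    using Suc.prems by (intro mult_right_mono) auto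
  ultimately have "(\<Sum>i=1..Suc k. a i * fact i) < Suc (Suc k) * fact (Suc k)"
    by simp
  then show ?case by (simp only: fact_Suc of_nat_id)
qed simp

lemma factoradic_digits_unique:
  fixes a b :: "nat \<Rightarrow> nat"
  assumes "\<forall>i\<in>{1..k}. a i \<le> i" "\<forall>i\<in>{1..k}. b i \<le> i"
    and "(\<Sum>i=1..k. a i * fact i) = (\<Sum>i=1..k. b i * fact i)"
  shows "\<forall>i\<in>{1..k}. a i = b i"
  using assms
proof (induction k)
  case (Suc k)
  define F :: nat where "F = fact (Suc k)"
  define A where "A = (\<Sum>i=1..k. a i * fact i)"
  define B where "B = (\<Sum>i=1..k. b i * fact i)"
  have lt: "A < F" "B < F"
    using Suc.prems factoradic_sum_less[of k a] factoradic_sum_less[of k b]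
    by (auto simp: F_def A_def B_def)
  have eq: "A + a (Suc k) * F = B + b (Suc k) * F"
    using Suc.prems(3) by (simp add: F_def A_def B_def)
  have "(A + a (Suc k) * F) div F = a (Suc k)" "(B + b (Suc k) * F) div F = b (Suc k)"
    using lt by auto
  then have top: "a (Suc k) = b (Suc k)" using eq by simp
  then have "A = B" using eq by simp
  moreover have "\<forall>i\<in>{1..k}. a i \<le> i" "\<forall>i\<in>{1..k}. b i \<le> i"
    using Suc.prems by auto
  ultimately have "\<forall>i\<in>{1..k}. a i = b i"
    unfolding A_def B_def by (intro Suc.IH)
  moreover have "{1..Suc k} = insert (Suc k) {1..k}" by auto
  ultimately show ?case using top by simp
qed simp

lemma factoradic_digits_exist:
  "n < fact (Suc k) \<Longrightarrow>
     \<exists>a. (\<forall>i\<in>{1..k}. a i \<le> i) \<and> n = (\<Sum>i=1..k. a i * fact i)" for n k :: nat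
proof (induction k arbitrary: n)
  case (Suc k)
  define F :: nat where "F = fact (Suc k)"
  have F: "F > 0" by (simp add: F_def)
  then have "n mod F < fact (Suc k)" by (simp add: F_def)
  then obtain a where a: "\<forall>i\<in>{1..k}. a i \<le> i" "n mod F = (\<Sum>i=1..k. a i * fact i)"
    using Suc.IH by blast
  have "n < Suc (Suc k) * F" using Suc.prems by (simp only: F_def fact_Suc of_nat_id)
  then have q: "n div F \<le> Suc k"
    using less_mult_imp_div_less[of n "Suc (Suc k)" F] by linarith
  define b where "b = a(Suc k := n div F)"
  have "(\<Sum>i=1..k. b i * fact i) = (\<Sum>i=1..k. a i * fact i)"
    by (rule sum.cong) (auto simp: b_def)
  then have "n = (\<Sum>i=1..Suc k. b i * fact i)"
    using a(2) div_mult_mod_eq[of n F] by (simp add: b_def F_def[symmetric] del: fact_Suc)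
  moreover have "\<forall>i\<in>{1..Suc k}. b i \<le> i" using a(1) q by (auto simp: b_def)
  ultimately show ?case by blast
qed simp

lemma factoradic_exists:
  assumes "n \<ge> 1"
  shows "\<exists>k a. is_factoradic n k a"
proof -
  have "n < fact (Suc n)" using fact_ge_self[of "Suc n"] by linarith
  define k where "k = (LEAST k. n < fact (Suc k))"
  have k: "n < fact (Suc k)" unfolding k_def by (rule LeastI) fact
  then obtain a where a: "\<forall>i\<in>{1..k}. a i \<le> i" "n = (\<Sum>i=1..k. a i * fact i)"
    using factoradic_digits_exist by blast
  have k1: "k \<ge> 1" using k assms by (cases k) auto
  then obtain m where m: "k = Suc m" by (cases k) auto
  have "\<not> n < fact (Suc m)" using not_less_Least[of m "\<lambda>k. n < fact (Suc k)"] m k_def by auto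
  moreover have "a k = 0 \<Longrightarrow> n < fact (Suc m)"
    using a factoradic_sum_less[of m a] m by auto
  ultimately have "a k \<noteq> 0" by blast
  then show ?thesis using k1 a unfolding is_factoradic_def by blast
qed

lemma factoradic_unique:
  assumes "is_factoradic n k a" "is_factoradic n l b"
  shows "k = l \<and> (\<forall>i\<in>{1..k}. a i = b i)"
proof -
  have bounds: "fact k \<le> n \<and> n < fact (Suc k)" if "is_factoradic n k a" for k a
  proof
    have "1 * fact k \<le> a k * fact k"
      using that by (intro mult_right_mono) (auto simp: is_factoradic_def)
    also have "\<dots> \<le> (\<Sum>i=1..k. a i * fact i)"
      using that by (intro member_le_sum) (auto simp: is_factoradic_def)
    finally show "fact k \<le> n" using that by (simp add: is_factoradic_def)
    show "n < fact (Suc k)"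
      using that factoradic_sum_less[of k a] by (auto simp: is_factoradic_def)
  qed
  have "\<not> k < l" "\<not> l < k"
    using bounds[OF assms(1)] bounds[OF assms(2)]
      fact_mono_nat[of "Suc k" l] fact_mono_nat[of "Suc l" k] by auto
  then have "k = l" by simp
  then show ?thesis
    using assms factoradic_digits_unique[of k a b] by (auto simp: is_factoradic_def)
qed

definition happy_factoradic :: "nat \<Rightarrow> nat \<Rightarrow> nat" where
  "happy_factoradic e n =
     (if n = 0 then 0
      else (THE s. \<exists>k a. is_factoradic n k a \<and> s = (\<Sum>i=1..k. a i ^ e)))"

lemma happy_factoradic_0 [simp]: "happy_factoradic e 0 = 0"
  by (simp add: happy_factoradic_def)

lemma happy_factoradic_eq:
  assumes "is_factoradic n k a" "n \<ge> 1"
  shows "happy_factoradic e n = (\<Sum>i=1..k. a i ^ e)"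
proof -
  have "(THE s. \<exists>k a. is_factoradic n k a \<and> s = (\<Sum>i=1..k. a i ^ e)) = (\<Sum>i=1..k. a i ^ e)"
  proof (rule the_equality)
    fix s assume "\<exists>k a. is_factoradic n k a \<and> s = (\<Sum>i=1..k. a i ^ e)"
    then obtain l b where b: "is_factoradic n l b" "s = (\<Sum>i=1..l. b i ^ e)" by blast
    then show "s = (\<Sum>i=1..k. a i ^ e)"
      using factoradic_unique[OF assms(1) b(1)] by auto
  qed (use assms(1) in blast)
  then show ?thesis using assms(2) by (simp add: happy_factoradic_def)
qed

definition factoradic_j :: "nat \<Rightarrow> nat" where
  "factoradic_j e = (LEAST j. j > 0 \<and> fact j > j ^ (e - 1))"

definition factoradic_M :: "nat \<Rightarrow> nat" where
  "factoradic_M e = (\<Sum>i=1..factoradic_j e. i * fact i)"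

end

theory Submission imports Defs begin

text \<open>A digit at a position \<open>i \<ge> j\<close> never contributes negatively to \<open>n - S(n)\<close>, because
  \<open>a * i! \<ge> a * i ^ (e - 1) \<ge> a ^ e\<close> for \<open>a \<le> i\<close>. Since \<open>n > M\<close>, the leading position \<open>k\<close>
  exceeds \<open>j\<close>, and the surplus \<open>k! - k ^ (e - 1)\<close> of the leading digit alone outweighs everything
  that the positions below \<open>j\<close> can lose, which is at most the sum of the \<open>i ^ e\<close> with \<open>i < j\<close>.\<close>

text \<open>Induction on \<open>l\<close>: the step multiplies the factorial by
  \<open>l + 1\<close>, and the left side grows by at most that factor. The constant
  \<open>c\<close> leaves room for the loss at low positions.\<close>

lemma add_power_less_fact_mono:
  fixes c m k l :: nat
  assumes "k \<le> l" "m \<le> 3" "3 \<le> k" "c + k ^ m < fact k"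
  shows "c + l ^ m < fact l"
  using assms(1)
proof (induction l rule: dec_induct)
  case (step l)
  have "Suc l ^ m \<le> Suc l * l ^ m"
  proof (cases m)
    case (Suc r)
    \<comment> \<open>Here \<open>r \<le> 2\<close>. This is where \<open>3 \<le> k\<close> enters:
      for \<open>l = 2\<close>, \<open>r = 2\<close> it would read \<open>9 \<le> 8\<close>.\<close>
    have "(l + 1) ^ r \<le> l ^ Suc r"
    proof -
      have l: "3 \<le> l" using step assms by simp
      have "3 * l \<le> l * l" "3 * (l * l) \<le> l * (l * l)"
        using l by (intro mult_right_mono; simp)+
      moreover have "r = 0 \<or> r = 1 \<or> r = 2" using Suc assms(2) by auto
      ultimately show ?thesis using l by (auto simp: power2_eq_square numeral_eq_Suc)
    qed
    from mult_le_mono2[OF this, of "Suc l"] show ?thesis using Suc by simp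
  qed simp
  then have "c + Suc l ^ m \<le> Suc l * (c + l ^ m)"
    by (simp add: distrib_left)
  also have "\<dots> < Suc l * fact l"
    using step.IH by (intro mult_strict_left_mono) auto
  finally show ?case by simp
qed (use assms in simp)

text \<open>The sum is the largest number whose leading position is at most \<open>j\<close>, all
  its digits being maximal.\<close>

lemma is_factoradic_less_lead:
  assumes "is_factoradic n k a" "(\<Sum>i=1..j. i * fact i) < n"
  shows "j < k"
proof (rule ccontr)
  assume "\<not> j < k"
  have "n \<le> (\<Sum>i=1..k. i * fact i)"
    using assms(1) by (auto simp: is_factoradic_def intro!: sum_mono)
  also have "\<dots> \<le> (\<Sum>i=1..j. i * fact i)"
    using \<open>\<not> j < k\<close> by (intro sum_mono2) auto
  finally show False using assms(2) by simp
qed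

lemma power_Suc_le_mult_power:
  fixes x y :: nat
  assumes "x \<le> y"
  shows "x ^ Suc m \<le> x * y ^ m"
  using assms by (simp add: power_mono)

lemma sum_digit_powers_less:
  assumes fac: "is_factoradic n k a"
    and j: "1 \<le> j" "j < k"
    and pow: "\<And>i. j \<le> i \<Longrightarrow> i < k \<Longrightarrow> i ^ m \<le> fact i"
    and lead: "(\<Sum>i=1..<j. i ^ Suc m) + k ^ m < fact k"
  shows "(\<Sum>i=1..k. a i ^ Suc m) < n"
proof -
  define S where "S = (\<Sum>i=1..<j. i ^ Suc m)"
  have le: "a i \<le> i" if "1 \<le> i" "i \<le> k" for i
    using fac that by (auto simp: is_factoradic_def)
  have n: "n = (\<Sum>i=1..k. a i * fact i)" and ak: "1 \<le> a k"
    using fac by (auto simp: is_factoradic_def)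
  have split: "(\<Sum>i=1..k. f i) = (\<Sum>i=1..<j. f i) + (\<Sum>i=j..<k. f i) + f k" for f :: "nat \<Rightarrow> nat"
    using j sum.atLeastLessThan_concat[of 1 j k f] by (simp add: sum.last_plus)
  have low: "(\<Sum>i=1..<j. a i ^ Suc m) \<le> S"
    unfolding S_def using j by (intro sum_mono power_mono le) auto
  have mid: "(\<Sum>i=j..<k. a i ^ Suc m) \<le> (\<Sum>i=j..<k. a i * fact i)"
  proof (intro sum_mono)
    fix i assume "i \<in> {j..<k}"
    then have "a i ^ Suc m \<le> a i * i ^ m" "a i * i ^ m \<le> a i * fact i"
      using j by (auto intro!: power_Suc_le_mult_power le pow mult_left_mono simp del: power_Suc)
    then show "a i ^ Suc m \<le> a i * fact i" by linarith
  qed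
  \<comment> \<open>Since \<open>a k \<ge> 1\<close>, inflating \<open>S\<close> to
    \<open>a k * S\<close> lets \<open>a k\<close> factor out, so \<open>lead\<close> applies for
    every leading digit.\<close>
  have "S + a k ^ Suc m \<le> a k * S + a k * k ^ m"
    using ak j by (intro add_mono power_Suc_le_mult_power le) auto
  also have "\<dots> = a k * (S + k ^ m)" by (simp add: distrib_left)
  also have "\<dots> < a k * fact k"
    using lead ak unfolding S_def by (intro mult_strict_left_mono) auto
  finally have top: "S + a k ^ Suc m < a k * fact k" .
  show ?thesis
    unfolding n split using low mid top by linarith
qed

text \<open>By growth, the conditions for all \<open>k > j\<close> reduce to two numerical checks.
  The second is made at \<open>Suc j\<close>, the least possible leading position; at
  \<open>j\<close> it fails for each \<open>e\<close> used below.\<close>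

lemma happy_factoradic_less:
  assumes e: "e = Suc m"
    and n: "(\<Sum>i=1..j. i * fact i) < n"
    and j: "3 \<le> j" "m \<le> 3" "j ^ m < fact j"
    and lead: "(\<Sum>i=1..<j. i ^ e) + Suc j ^ m < fact (Suc j)"
  shows "happy_factoradic e n < n"
proof -
  have "1 \<le> n" using n by simp
  then obtain k a where fac: "is_factoradic n k a" using factoradic_exists by blast
  have "j < k" using is_factoradic_less_lead[OF fac n] .
  have "(\<Sum>i=1..k. a i ^ Suc m) < n"
  proof (rule sum_digit_powers_less[OF fac _ \<open>j < k\<close>])
    show "i ^ m \<le> fact i" if "j \<le> i" for i
      using add_power_less_fact_mono[of j i m 0] that j by simp
    show "(\<Sum>i=1..<j. i ^ Suc m) + k ^ m < fact k"
      using \<open>j < k\<close> j lead e by (intro add_power_less_fact_mono[of "Suc j" k]) auto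
  qed (use j in simp)
  then show ?thesis using happy_factoradic_eq[OF fac \<open>1 \<le> n\<close>] e by simp
qed

lemma factoradic_j_eqI:
  assumes "0 < j" "j ^ (e - 1) < fact j" "\<forall>i\<in>{1..<j}. fact i \<le> i ^ (e - 1)"
  shows "factoradic_j e = j"
  unfolding factoradic_j_def
proof (rule Least_equality)
  fix i assume "0 < i \<and> i ^ (e - 1) < fact i"
  then show "j \<le> i" using assms(3) by (force simp: not_less[symmetric])
qed (use assms in simp)

theorem theorem2p6:
  fixes e n :: nat
  assumes "e \<in> {2, 3, 4}"
    and "n > 0"
    and "n > factoradic_M e"
  shows "int n - int (happy_factoradic e n) > 0"
proof -
  \<comment> \<open>For \<open>e = 4\<close> the value 5 just fails:
    \<open>5! = 120 < 125 = 5^3\<close>.\<close>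
  have j: "factoradic_j 2 = 3" "factoradic_j 3 = 4" "factoradic_j 4 = 6"
    by (rule factoradic_j_eqI; simp add: fact_numeral atLeastLessThan_nat_numeral)+
  consider "e = 2" | "e = 3" | "e = 4" using assms(1) by blast
  then have "happy_factoradic e n < n"
  proof cases
    case 1
    then show ?thesis using happy_factoradic_less[of 2 1 3 n] assms(3) j
      by (simp add: factoradic_M_def fact_numeral atLeastLessThanSuc_atLeastAtMost[symmetric] atLeastLessThan_nat_numeral)
  next
    case 2
    then show ?thesis using happy_factoradic_less[of 3 2 4 n] assms(3) j
      by (simp add: factoradic_M_def fact_numeral atLeastLessThanSuc_atLeastAtMost[symmetric] atLeastLessThan_nat_numeral)
  next
    case 3
    then show ?thesis using happy_factoradic_less[of 4 3 6 n] assms(3) j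
      by (simp add: factoradic_M_def fact_numeral atLeastLessThanSuc_atLeastAtMost[symmetric] atLeastLessThan_nat_numeral)
  qed
  then show ?thesis by simp
qed

end
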